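(* Let $q$ be a prime power and $k>1$ an integer. Let $\Pi = PG(2,q^k)$ be the Desarguesian projective plane over $\mathbb{F}_{q^k}$ and $\pi = PG(2,q)$ a subplane of $\Pi$ (over the subfield $\mathbb{F}_q$). Choose a point $D$ of $\pi$, let $\mathcal{S}$ be the set of lines of $\Pi$ of the form $\overline{Dp}$ with $p$ a point of $\pi$ different from $D$, let $\mathcal{P}=\bigcup\mathcal{S}$ (the set of points of $\Pi$ lying on some line of $\mathcal{S}$), and let $\mathcal{O}$ be the set of restrictions $L\cap\mathcal{P}$ of the lines $L$ of $\Pi$ not containing $D$. Let $R(q,q^k)$ be the incidence structure with point set $\mathcal{P}$ and line set $\mathcal{S}\cup\mathcal{O}$ (the pseudo-projective rectangle). Then the graph whose vertices are the elements of $\mathcal{O}$ (the ordinary lines), two being adjacent iff they have a common point in $\mathcal{P}$, is isomorphic to the bilinear forms graph $H_q(2,k)$.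
   Context: For a prime power $q$ and positive integer $k$, the bilinear forms graph $H_q(2,k)$ has as vertices all $2\times k$ matrices over $\mathbb{F}_q$, two matrices being adjacent iff their difference has rank $1$. *)

theory Defs
  imports "HOL-Analysis.Analysis" "HOL-Number_Theory.Prime_Powers"
begin

text \<open>A graph is a vertex set with an adjacency relation, read only on the vertex set.\<close>

type_synonym 'v graph = "'v set \<times> ('v \<Rightarrow> 'v \<Rightarrow> bool)"

definition graph_isomorphic :: "'v graph \<Rightarrow> 'w graph \<Rightarrow> bool" where
  "graph_isomorphic G H \<longleftrightarrow>
     (\<exists>f. bij_betw f (fst G) (fst H) \<and>
          (\<forall>x\<in>fst G. \<forall>y\<in>fst G. snd G x y \<longleftrightarrow> snd H (f x) (f y)))"

text \<open>The graph \<open>H\<^sub>q(2,k)\<close>, where \<open>q\<close> and \<open>k\<close> are the cardinalities of the types \<open>'f\<close> and \<open>'k\<close>;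
  \<open>'f^'k^2\<close> is the type of matrices with 2 rows and \<open>k\<close> columns.\<close>

definition bilinear_forms_graph :: "('f::{field,finite}^'k^2) graph" where
  "bilinear_forms_graph = (UNIV, \<lambda>A B. rank (A - B) = 1)"

text \<open>The plane \<open>PG(2,F)\<close> over the field type \<open>'e\<close>: a point is a one-dimensional subspace of
  \<open>'e^3\<close>, and a line is the set of points contained in a two-dimensional subspace.\<close>

type_synonym 'e pg_point = "('e^3) set"

definition pg_points :: "'e::field pg_point set" where
  "pg_points = {P. vec.subspace P \<and> vec.dim P = 1}"

definition pg_lines :: "'e::field pg_point set set" where
  "pg_lines = {{P \<in> pg_points. P \<subseteq> W} | W. vec.subspace W \<and> vec.dim W = 2}"

definition field_embedding :: "('f::field \<Rightarrow> 'e::field) \<Rightarrow> bool" where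
  "field_embedding \<iota> \<longleftrightarrow>
     \<iota> 1 = 1 \<and> (\<forall>x y. \<iota> (x + y) = \<iota> x + \<iota> y) \<and> (\<forall>x y. \<iota> (x * y) = \<iota> x * \<iota> y)"

text \<open>The point sets of the subplanes over the subfield \<open>range \<iota>\<close>: with respect to some basis of
  \<open>'e^3\<close> (the columns of \<open>M\<close>), the points that have homogeneous coordinates in the subfield.\<close>

definition is_subplane_over ::
    "('f::field \<Rightarrow> 'e::field) \<Rightarrow> 'e pg_point set \<Rightarrow> bool" where
  "is_subplane_over \<iota> \<pi> \<longleftrightarrow>
     (\<exists>M :: 'e^3^3. invertible M \<and>
        \<pi> = {vec.span {M *v (\<chi> i. \<iota> (x $ i))} | x :: 'f^3. x \<noteq> 0})"

text \<open>An incidence structure is a set of points with a set of lines, lines being sets of points.\<close>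

type_synonym 'p incidence_structure = "'p set \<times> 'p set set"

definition special_lines ::
    "'e::field pg_point set \<Rightarrow> 'e pg_point \<Rightarrow> 'e pg_point set set" where
  "special_lines \<pi> D = {L \<in> pg_lines. \<exists>p\<in>\<pi>. p \<noteq> D \<and> D \<in> L \<and> p \<in> L}"

definition rectangle_points ::
    "'e::field pg_point set \<Rightarrow> 'e pg_point \<Rightarrow> 'e pg_point set" where
  "rectangle_points \<pi> D = \<Union> (special_lines \<pi> D)"

definition ordinary_lines ::
    "'e::field pg_point set \<Rightarrow> 'e pg_point \<Rightarrow> 'e pg_point set set" where
  "ordinary_lines \<pi> D = {L \<inter> rectangle_points \<pi> D | L. L \<in> pg_lines \<and> D \<notin> L}"

definition pseudo_projective_rectangle ::
    "'e::field pg_point set \<Rightarrow> 'e pg_point \<Rightarrow> 'e pg_point incidence_structure" where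
  "pseudo_projective_rectangle \<pi> D =
     (rectangle_points \<pi> D, special_lines \<pi> D \<union> ordinary_lines \<pi> D)"

text \<open>The graph on a family \<open>\<L>\<close> of lines of an incidence structure \<open>R\<close>, two distinct lines being
  adjacent iff they have a common point in \<open>R\<close>.\<close>

definition line_graph :: "'p incidence_structure \<Rightarrow> 'p set set \<Rightarrow> 'p set graph" where
  "line_graph R \<L> = (\<L>, \<lambda>l m. l \<noteq> m \<and> (\<exists>x\<in>fst R. x \<in> l \<and> x \<in> m))"

end

theory Submission
  imports Defs
begin

text \<open>
  In a frame with \<open>D = \<langle>(1, 0, 0)\<rangle>\<close>, the lines avoiding \<open>D\<close> are
  \<open>a + u b + v c = 0\<close> with arbitrary \<open>u, v\<close> in the big field, and a point \<open>\<langle>(a, b, c)\<rangle>\<close> belongs to the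
  rectangle iff \<open>(b, c)\<close> is proportional to a nonzero vector \<open>(s, t)\<close> over the small field.
  Hence the lines \<open>(u, v)\<close> and \<open>(u', v')\<close> meet in the rectangle iff
  \<open>s (u - u') + t (v - v') = 0\<close> for some such \<open>(s, t)\<close>. Expanding \<open>u\<close> and \<open>v\<close> in a basis of the
  big field over the small one gives the two rows of a matrix, and the condition says that the rows
  of the difference of the two matrices are linearly dependent.
\<close>

section \<open>Field embeddings and coordinates over the subfield\<close>

lemma field_embedding_basics:
  assumes "field_embedding \<iota>"
  shows field_embedding_one: "\<iota> 1 = 1"
    and field_embedding_add: "\<iota> (x + y) = \<iota> x + \<iota> y"
    and field_embedding_mult: "\<iota> (x * y) = \<iota> x * \<iota> y"
    and field_embedding_zero: "\<iota> 0 = 0"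
    and field_embedding_minus: "\<iota> (x - y) = \<iota> x - \<iota> y"
    and field_embedding_eq_0_iff: "\<iota> x = 0 \<longleftrightarrow> x = 0"
    and field_embedding_sum: "\<iota> (sum g A) = (\<Sum>i\<in>A. \<iota> (g i))"
proof -
  show one: "\<iota> 1 = 1" and add: "\<And>x y. \<iota> (x + y) = \<iota> x + \<iota> y"
    and mult: "\<And>x y. \<iota> (x * y) = \<iota> x * \<iota> y"
    using assms unfolding field_embedding_def by auto
  show zero: "\<iota> 0 = 0"
    using add[of 0 0] by (metis add.right_neutral add_left_cancel)
  show "\<iota> (x - y) = \<iota> x - \<iota> y"
    using add[of "x - y" y] by (simp add: algebra_simps)
  show "\<iota> x = 0 \<longleftrightarrow> x = 0"
    using mult[of x "inverse x"] one zero by (cases "x = 0") auto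
  show "\<iota> (sum g A) = (\<Sum>i\<in>A. \<iota> (g i))"
    by (induction A rule: infinite_finite_induct) (simp_all add: zero add)
qed

text \<open>Through \<open>\<iota>\<close> the big field is a vector space over the small one.
  Counting coordinate vectors with respect to a basis gives a power of \<open>CARD('f)\<close>, and
  comparison with the assumed cardinality shows that the basis has \<open>CARD('k)\<close> elements,
  so it can be indexed by \<open>'k\<close>.\<close>

lemma field_embedding_coordinates:
  fixes \<iota> :: "'f::{field,finite} \<Rightarrow> 'e::{field,finite}"
  assumes emb: "field_embedding \<iota>" and card: "CARD('e) = CARD('f) ^ CARD('k::finite)"
  obtains \<phi> :: "'f^'k \<Rightarrow> 'e" where "bij \<phi>" "\<And>x y. \<phi> (x + y) = \<phi> x + \<phi> y"
    "\<And>c x. \<phi> (c *s x) = \<iota> c * \<phi> x"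
proof -
  note [simp] = field_embedding_basics[OF emb]
  interpret E: vector_space "\<lambda>c x. \<iota> c * x"
    by unfold_locales (simp_all add: algebra_simps)
  obtain B where ind: "E.independent B" and gen: "UNIV \<subseteq> E.span B"
    using E.maximal_independent_subset[of UNIV] by blast
  define comb where "comb u = (\<Sum>b\<in>B. \<iota> (u b) * b)" for u
  \<comment> \<open>Coefficient functions are restricted to \<open>B\<close>, so that each element
    of the big field is counted exactly once.\<close>
  have "bij_betw comb (B \<rightarrow>\<^sub>E UNIV) UNIV"
  proof (rule bij_betw_imageI)
    show "inj_on comb (B \<rightarrow>\<^sub>E UNIV)"
    proof (rule inj_onI)
      fix u v assume uv: "u \<in> B \<rightarrow>\<^sub>E UNIV" "v \<in> B \<rightarrow>\<^sub>E UNIV" "comb u = comb v"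
      have "(\<Sum>b\<in>B. \<iota> (u b - v b) * b) = 0"
        using uv(3) by (simp add: comb_def algebra_simps sum_subtractf)
      then have "u b - v b = 0" if "b \<in> B" for b
        using E.independentD[OF ind finite subset_refl, of "\<lambda>b. u b - v b"] that by simp
      then show "u = v"
        using uv(1,2) by (intro PiE_ext) auto
    qed
    have "x \<in> comb ` (B \<rightarrow>\<^sub>E UNIV)" for x
    proof -
      have "x \<in> range comb"
        using gen unfolding E.span_finite[OF finite] comb_def by auto
      then obtain u where "x = comb u" by auto
      also have "\<dots> = comb (restrict u B)" by (simp add: comb_def)
      finally show ?thesis by auto
    qed
    then show "comb ` (B \<rightarrow>\<^sub>E UNIV) = UNIV" by auto
  qed
  then have "CARD('e) = card (B \<rightarrow>\<^sub>E (UNIV :: 'f set))"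
    by (metis bij_betw_same_card)
  then have "CARD('f) ^ CARD('k) = CARD('f) ^ card B"
    using card by (simp add: card_PiE)
  \<comment> \<open>A field has at least two elements, so equal powers of its cardinality have equal
    exponents.\<close>
  moreover have "card {0, 1 :: 'f} \<le> CARD('f)"
    by (intro card_mono) auto
  ultimately have "card B = CARD('k)"
    by simp
  then obtain b where b: "bij_betw b (UNIV :: 'k set) B"
    using finite_same_card_bij[of "UNIV :: 'k set" B] by auto
  define \<phi> where "\<phi> x = (\<Sum>i\<in>UNIV. \<iota> (x $ i) * b i)" for x :: "'f^'k"
  show thesis
  proof
    show "\<phi> (x + y) = \<phi> x + \<phi> y" for x y
      by (simp add: \<phi>_def algebra_simps sum.distrib)
    show "\<phi> (c *s x) = \<iota> c * \<phi> x" for c x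
      by (simp add: \<phi>_def algebra_simps sum_distrib_left)
    have "y \<in> range \<phi>" for y
    proof -
      obtain u where "y = comb u"
        using \<open>bij_betw comb _ UNIV\<close> unfolding bij_betw_def by blast
      then have "y = \<phi> (\<chi> i. u (b i))"
        by (simp add: \<phi>_def comb_def sum.reindex_bij_betw[OF b, of "\<lambda>x. \<iota> (u x) * x"])
      then show ?thesis by blast
    qed
    then have "surj \<phi>" by blast
    moreover have "CARD('f^'k) = CARD('e)"
      using card by (simp add: CARD_vec)
    ultimately show "bij \<phi>"
      by (metis bij_betw_def eq_card_imp_inj_on finite)
  qed
qed

section \<open>Matrices of rank one with two rows\<close>

text \<open>The rank is the dimension of the span of the two rows. It is at most 1 exactly when they
  are dependent, and it is 0 only for the zero matrix.\<close>

lemma rank_eq_1_iff_rows_dependent: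
  fixes A :: "'f::field^'k^2"
  shows "rank A = 1 \<longleftrightarrow> A \<noteq> 0 \<and> (\<exists>s t. (s \<noteq> 0 \<or> t \<noteq> 0) \<and> s *s A $ 1 + t *s A $ 2 = 0)"
proof -
  have rows: "rows A = {A $ 1, A $ 2}"
    unfolding rows_def row_def by (auto simp: UNIV_2)
  have A0: "A = 0 \<longleftrightarrow> A $ 1 = 0 \<and> A $ 2 = 0"
    by (simp add: vec_eq_iff[of A] forall_2)
  \<comment> \<open>This asymmetric form of dependence matches the dimension of a span computed by
    inserting one row after the other.\<close>
  have dep: "(\<exists>s t. (s \<noteq> 0 \<or> t \<noteq> 0) \<and> s *s x + t *s y = 0) \<longleftrightarrow> y = 0 \<or> (\<exists>c. x = c *s y)"
    for x y :: "'f^'k"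
  proof
    assume "\<exists>s t. (s \<noteq> 0 \<or> t \<noteq> 0) \<and> s *s x + t *s y = 0"
    then obtain s t where st: "s \<noteq> 0 \<or> t \<noteq> 0" "s *s x + t *s y = 0" by blast
    show "y = 0 \<or> (\<exists>c. x = c *s y)"
    proof (cases "s = 0")
      case False
      have "x = inverse s *s (s *s x)" using False by simp
      also have "s *s x = - t *s y" using st(2) by (simp add: eq_neg_iff_add_eq_0)
      finally show ?thesis by (metis vector_smult_assoc)
    qed (use st in auto)
  next
    assume "y = 0 \<or> (\<exists>c. x = c *s y)"
    then show "\<exists>s t. (s \<noteq> 0 \<or> t \<noteq> 0) \<and> s *s x + t *s y = 0"
    proof
      assume "y = 0"
      then show ?thesis by (intro exI[of _ 0] exI[of _ 1]) simp
    next
      assume "\<exists>c. x = c *s y"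
      then obtain c where "x = c *s y" ..
      then show ?thesis by (intro exI[of _ "1"] exI[of _ "- c"]) (simp add: vec_eq_iff)
    qed
  qed
  show ?thesis
    unfolding row_rank_def_gen rows A0 dep
    by (auto simp: vec.dim_insert vec.span_singleton)
qed

section \<open>A frame of the subplane with \<open>D\<close> as its first point\<close>

text \<open>A nonzero vector extends to a basis by the two standard vectors that belong to its other
  coordinates, once a nonzero coordinate is singled out.\<close>

lemma invertible_with_first_column:
  fixes d :: "'f::field^3"
  assumes "d \<noteq> 0"
  obtains N :: "'f^3^3" where "invertible N" "N *v vector [1, 0, 0] = d"
proof -
  consider "d $ 1 \<noteq> 0" | "d $ 2 \<noteq> 0" | "d $ 3 \<noteq> 0"
    using assms by (auto simp: vec_eq_iff forall_3)
  then obtain N :: "'f^3^3" where "det N \<noteq> 0" "N *v vector [1, 0, 0] = d"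
  proof cases
    case 1
    show thesis
      by (rule that[of "vector [vector [d$1, 0, 0], vector [d$2, 1, 0], vector [d$3, 0, 1]]"])
        (use 1 in \<open>simp_all add: det_3 vec_eq_iff forall_3 matrix_vector_mult_def sum_3\<close>)
  next
    case 2
    show thesis
      by (rule that[of "vector [vector [d$1, 1, 0], vector [d$2, 0, 0], vector [d$3, 0, 1]]"])
        (use 2 in \<open>simp_all add: det_3 vec_eq_iff forall_3 matrix_vector_mult_def sum_3\<close>)
  next
    case 3
    show thesis
      by (rule that[of "vector [vector [d$1, 1, 0], vector [d$2, 0, 1], vector [d$3, 0, 0]]"])
        (use 3 in \<open>simp_all add: det_3 vec_eq_iff forall_3 matrix_vector_mult_def sum_3\<close>)
  qed
  then show thesis
    using that by (simp add: invertible_det_nz)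
qed

text \<open>A change of basis over the small field permutes its nonzero coordinate vectors and hence
  preserves the subplane. Choosing it to send (1, 0, 0) to the coordinates of \<open>D\<close> makes
  \<open>D\<close> the first frame point.\<close>

lemma subplane_frame_at_point:
  fixes \<iota> :: "'f::field \<Rightarrow> 'e::field"
  assumes emb: "field_embedding \<iota>" and sub: "is_subplane_over \<iota> \<pi>" and D: "D \<in> \<pi>"
  obtains M :: "'e^3^3" where "invertible M"
    "\<pi> = {vec.span {M *v (\<chi> i. \<iota> (x $ i))} | x :: 'f^3. x \<noteq> 0}"
    "D = vec.span {M *v vector [1, 0, 0]}"
proof -
  note [simp] = field_embedding_basics[OF emb]
  define h :: "'f^3 \<Rightarrow> 'e^3" where "h x = (\<chi> i. \<iota> (x $ i))" for x
  obtain M :: "'e^3^3" where M: "invertible M"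
    "\<pi> = {vec.span {M *v h x} | x. x \<noteq> 0}"
    using sub unfolding is_subplane_over_def h_def by blast
  obtain d where d: "d \<noteq> 0" "D = vec.span {M *v h d}"
    using D M by blast
  obtain N :: "'f^3^3" where N: "invertible N" "N *v vector [1, 0, 0] = d"
    using invertible_with_first_column[OF d(1)] .
  obtain N' where N': "N ** N' = mat 1" "N' ** N = mat 1"
    using N(1) unfolding invertible_def by blast
  \<comment> \<open>Applying \<open>\<iota>\<close> entrywise respects products and the identity, so
    the inverse of \<open>N\<close> over the small field yields one of \<open>hm N\<close> over the
    big field.\<close>
  define hm :: "'f^3^3 \<Rightarrow> 'e^3^3" where "hm A = (\<chi> i j. \<iota> (A $ i $ j))" for A
  have hm_mult: "hm (A ** B) = hm A ** hm B" for A B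
    by (simp add: hm_def matrix_matrix_mult_def vec_eq_iff)
  have hm_1: "hm (mat 1) = mat 1"
    by (simp add: hm_def mat_def vec_eq_iff)
  have hm_h: "hm A *v h x = h (A *v x)" for A x
    by (simp add: hm_def h_def matrix_vector_mult_def vec_eq_iff)
  have "invertible (hm N)"
    unfolding invertible_def using hm_mult[of N N'] hm_mult[of N' N] N' hm_1 by metis
  then have inv: "invertible (M ** hm N)"
    using M(1) by (simp add: invertible_mult)
  have MN: "(M ** hm N) *v h x = M *v h (N *v x)" for x
    by (simp add: matrix_vector_mul_assoc[symmetric] hm_h)
  have NN': "N *v (N' *v x) = x" "N' *v (N *v x) = x" for x
    by (simp_all add: matrix_vector_mul_assoc N')
  have nz: "N *v x \<noteq> 0 \<longleftrightarrow> x \<noteq> 0" "N' *v x \<noteq> 0 \<longleftrightarrow> x \<noteq> 0" for x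
    by (metis NN' matrix_vector_mult_0_right)+
  have "\<pi> = {vec.span {(M ** hm N) *v h x} | x. x \<noteq> 0}"
    unfolding M(2) MN by (safe; metis NN' nz)
  moreover have "h (vector [1, 0, 0]) = vector [1, 0, 0]"
    by (simp add: h_def vec_eq_iff forall_3)
  then have "D = vec.span {(M ** hm N) *v vector [1, 0, 0]}"
    unfolding d(2) using MN[of "vector [1, 0, 0]"] N(2) by simp
  ultimately show thesis
    using that[OF inv] unfolding h_def by blast
qed


lemma pg_points_iff: "P \<in> pg_points \<longleftrightarrow> (\<exists>w. w \<noteq> 0 \<and> P = vec.span {w})"
proof
  assume P: "P \<in> pg_points"
  then have P': "vec.subspace P" "vec.dim P = 1"
    by (simp_all add: pg_points_def)
  obtain B where B: "B \<subseteq> P" "vec.independent B" "P \<subseteq> vec.span B" "card B = 1"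
    using vec.basis_exists[of P] P'(2) by metis
  then obtain w where "B = {w}"
    by (auto simp: card_1_singleton_iff)
  moreover have "P = vec.span B"
    using B P'(1) by (simp add: subset_antisym vec.span_minimal)
  ultimately show "\<exists>w. w \<noteq> 0 \<and> P = vec.span {w}"
    using B(2) vec.dependent_single by blast
next
  assume "\<exists>w. w \<noteq> 0 \<and> P = vec.span {w}"
  then show "P \<in> pg_points"
    by (auto simp: pg_points_def vec.dim_insert)
qed

lemma span_singleton_subset_iff:
  "vec.subspace W \<Longrightarrow> vec.span {w} \<subseteq> W \<longleftrightarrow> w \<in> W"
  by (metis insert_subset vec.span_base vec.span_minimal empty_subsetI insertI1 subsetD)

text \<open>This allows the isomorphism to be built from matrices to lines, the direction in which
  it has an explicit formula.\<close>

lemma graph_isomorphic_sym: "graph_isomorphic G H \<Longrightarrow> graph_isomorphic H G"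
proof -
  assume "graph_isomorphic G H"
  then obtain f where f: "bij_betw f (fst G) (fst H)"
    "\<forall>x\<in>fst G. \<forall>y\<in>fst G. snd G x y \<longleftrightarrow> snd H (f x) (f y)"
    unfolding graph_isomorphic_def by blast
  let ?g = "inv_into (fst G) f"
  have "bij_betw ?g (fst H) (fst G)"
    using f(1) by (rule bij_betw_inv_into)
  moreover have "snd H x y \<longleftrightarrow> snd G (?g x) (?g y)" if "x \<in> fst H" "y \<in> fst H" for x y
  proof -
    have "?g x \<in> fst G" "?g y \<in> fst G" "f (?g x) = x" "f (?g y) = y"
      using f(1) that by (auto simp: bij_betw_def inv_into_into f_inv_into_f)
    then show ?thesis using f(2) by simp
  qed
  ultimately show ?thesis
    unfolding graph_isomorphic_def by blast
qed

section \<open>Homogeneous coordinates and the points of the rectangle\<close>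

locale subplane_frame =
  fixes \<iota> :: "'f::field \<Rightarrow> 'e::field" and M :: "'e^3^3"
    and \<pi> :: "'e pg_point set" and D :: "'e pg_point"
  assumes emb: "field_embedding \<iota>" and inv: "invertible M"
    and \<pi>_eq: "\<pi> = {vec.span {M *v (\<chi> i. \<iota> (x $ i))} | x :: 'f^3. x \<noteq> 0}"
    and D_eq: "D = vec.span {M *v vector [1, 0, 0]}"
begin

text \<open>Coordinates are taken with respect to the columns of \<open>M\<close>, so that geometric
  statements become equations in \<open>a\<close>, \<open>b\<close>, \<open>c\<close>.\<close>

definition pt :: "'e \<Rightarrow> 'e \<Rightarrow> 'e \<Rightarrow> 'e^3" where
  "pt a b c = M *v vector [a, b, c]"

lemma pt_add: "pt a b c + pt a' b' c' = pt (a + a') (b + b') (c + c')"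
  unfolding pt_def matrix_vector_right_distrib[symmetric]
  by (rule arg_cong[of _ _ "(*v) M"]) (simp add: vec_eq_iff forall_3)

lemma pt_scale: "r *s pt a b c = pt (r * a) (r * b) (r * c)"
  unfolding pt_def vector_scalar_commute[symmetric]
  by (rule arg_cong[of _ _ "(*v) M"]) (simp add: vec_eq_iff forall_3)

lemma pt_diff: "pt a b c - pt a' b' c' = pt (a - a') (b - b') (c - c')"
  using pt_add[of "a - a'" "b - b'" "c - c'" a' b' c'] by (simp add: algebra_simps)

lemma pt_eq_iff [simp]: "pt a b c = pt a' b' c' \<longleftrightarrow> a = a' \<and> b = b' \<and> c = c'"
proof -
  have "inj ((*v) M)"
    using inv by (simp add: inj_matrix_vector_mult)
  then have "pt a b c = pt a' b' c' \<longleftrightarrow> vector [a, b, c] = (vector [a', b', c'] :: 'e^3)"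
    unfolding pt_def by (rule inj_eq)
  then show ?thesis
    by (simp add: vec_eq_iff forall_3)
qed

lemma pt_zero: "pt 0 0 0 = 0"
  using pt_scale[of 0 0 0 0] by simp

lemma pt_eq_0_iff [simp]: "pt a b c = 0 \<longleftrightarrow> a = 0 \<and> b = 0 \<and> c = 0"
  by (metis pt_zero pt_eq_iff)

lemma pt_cases: obtains a b c where "w = pt a b c"
proof -
  obtain M' where "M ** M' = mat 1"
    using inv unfolding invertible_def by blast
  then have "w = M *v (M' *v w)"
    by (simp add: matrix_vector_mul_assoc)
  also have "M' *v w = vector [(M' *v w) $ 1, (M' *v w) $ 2, (M' *v w) $ 3]"
    by (simp add: vec_eq_iff forall_3)
  finally show thesis
    using that unfolding pt_def by blast
qed

lemma span_pt: "vec.span {pt a b c} = {pt (r * a) (r * b) (r * c) | r. True}"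
  by (auto simp: vec.span_singleton pt_scale)

lemma span_pt2: "vec.span {pt a b c, pt a' b' c'}
  = {pt (r * a + s * a') (r * b + s * b') (r * c + s * c') | r s. True}"
proof -
  have "w \<in> vec.span {pt a b c, pt a' b' c'} \<longleftrightarrow>
    (\<exists>r s. w = pt (r * a + s * a') (r * b + s * b') (r * c + s * c'))" for w
    by (simp add: vec.span_breakdown_eq pt_scale diff_eq_eq pt_add[symmetric] span_pt add.commute)
  then show ?thesis by blast
qed

lemma D_pt: "D = vec.span {pt 1 0 0}"
  by (simp add: D_eq pt_def)

lemma mem_\<pi>_iff: "p \<in> \<pi> \<longleftrightarrow>
  (\<exists>r s t. (r \<noteq> 0 \<or> s \<noteq> 0 \<or> t \<noteq> 0) \<and> p = vec.span {pt (\<iota> r) (\<iota> s) (\<iota> t)})"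
proof -
  have vec: "(\<chi> i. \<iota> (x $ i)) = vector [\<iota> (x $ 1), \<iota> (x $ 2), \<iota> (x $ 3)]" for x :: "'f^3"
    by (simp add: vec_eq_iff forall_3)
  have "(\<exists>x :: 'f^3. x \<noteq> 0 \<and> Q (x $ 1) (x $ 2) (x $ 3)) \<longleftrightarrow>
    (\<exists>r s t. (r \<noteq> 0 \<or> s \<noteq> 0 \<or> t \<noteq> 0) \<and> Q r s t)" for Q
  proof
    assume "\<exists>r s t. (r \<noteq> 0 \<or> s \<noteq> 0 \<or> t \<noteq> 0) \<and> Q r s t"
    then obtain r s t where "(r \<noteq> 0 \<or> s \<noteq> 0 \<or> t \<noteq> 0) \<and> Q r s t" by blast
    then show "\<exists>x :: 'f^3. x \<noteq> 0 \<and> Q (x $ 1) (x $ 2) (x $ 3)"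
      by (intro exI[of _ "vector [r, s, t]"]) (auto simp: vec_eq_iff forall_3)
  qed (auto simp: vec_eq_iff forall_3)
  from this[of "\<lambda>r s t. p = vec.span {pt (\<iota> r) (\<iota> s) (\<iota> t)}"] show ?thesis
    unfolding \<pi>_eq vec pt_def by auto
qed

text \<open>Joining \<open>D\<close> to a subplane point with coordinates \<open>(r, s, t)\<close>
  over the small field leaves the first coordinate free and makes \<open>(b, c)\<close> a multiple
  of \<open>(\<iota> s, \<iota> t)\<close>. The cross-multiplied equation also covers
  \<open>b = c = 0\<close>, which is \<open>D\<close> itself.\<close>

lemma rectangle_points_iff:
  assumes "pt a b c \<noteq> 0"
  shows "vec.span {pt a b c} \<in> rectangle_points \<pi> D \<longleftrightarrow>
    (\<exists>s t. (s \<noteq> 0 \<or> t \<noteq> 0) \<and> b * \<iota> t = c * \<iota> s)"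
proof
  note [simp] = field_embedding_basics[OF emb]
  assume "vec.span {pt a b c} \<in> rectangle_points \<pi> D"
  then obtain W p where W: "vec.subspace W" "vec.dim W = 2" "vec.span {pt a b c} \<subseteq> W"
    and p: "p \<in> \<pi>" "p \<noteq> D" "D \<subseteq> W" "p \<subseteq> W"
    unfolding rectangle_points_def special_lines_def pg_lines_def by auto
  obtain r s t where rst: "r \<noteq> 0 \<or> s \<noteq> 0 \<or> t \<noteq> 0" "p = vec.span {pt (\<iota> r) (\<iota> s) (\<iota> t)}"
    using p(1) unfolding mem_\<pi>_iff by blast
  have st: "s \<noteq> 0 \<or> t \<noteq> 0"
  proof (rule ccontr)
    assume *: "\<not> (s \<noteq> 0 \<or> t \<noteq> 0)"
    then have "p = vec.span {pt (\<iota> r) 0 0}" "\<iota> r \<noteq> 0"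
      using rst by auto
    then have "p = D"
      unfolding D_pt span_pt by (auto, metis div_by_1 nonzero_eq_divide_eq)
    with p(2) show False ..
  qed
  let ?B = "{pt (\<iota> r) (\<iota> s) (\<iota> t), pt 1 0 0}"
  \<comment> \<open>By \<open>st\<close> the two vectors are independent; lying in the
    two-dimensional \<open>W\<close>, they span it.\<close>
  have "vec.dim ?B = 2"
    using st by (auto simp: vec.dim_insert span_pt)
  moreover have sub: "?B \<subseteq> W"
    using p(3,4) rst(2) W(1) by (simp add: D_pt span_singleton_subset_iff)
  ultimately have "vec.span ?B = W"
    using W by (metis order_refl vec.dim_span vec.span_minimal vec.subspace_dim_equal vec.subspace_span)
  then have "pt a b c \<in> vec.span ?B"
    using W by (simp add: span_singleton_subset_iff)
  then obtain x where "b = x * \<iota> s" "c = x * \<iota> t"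
    by (auto simp: span_pt2)
  then show "\<exists>s t. (s \<noteq> 0 \<or> t \<noteq> 0) \<and> b * \<iota> t = c * \<iota> s"
    using st by (intro exI[of _ s] exI[of _ t]) simp
next
  note [simp] = field_embedding_basics[OF emb]
  assume "\<exists>s t. (s \<noteq> 0 \<or> t \<noteq> 0) \<and> b * \<iota> t = c * \<iota> s"
  then obtain s t where st: "s \<noteq> 0 \<or> t \<noteq> 0" "b * \<iota> t = c * \<iota> s" by blast
  let ?p = "pt 0 (\<iota> s) (\<iota> t)"
  let ?W = "vec.span {?p, pt 1 0 0}"
  let ?L = "{P \<in> pg_points. P \<subseteq> ?W}"
  have "vec.dim ?W = 2"
    using st by (auto simp: vec.dim_insert span_pt)
  then have "?L \<in> pg_lines"
    unfolding pg_lines_def by blast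
  moreover have "vec.span {?p} \<in> \<pi>"
    using st(1) unfolding mem_\<pi>_iff by (intro exI[of _ 0] exI[of _ s] exI[of _ t]) simp
  moreover have "vec.span {?p} \<noteq> D"
  proof
    assume "vec.span {?p} = D"
    then have "?p \<in> D" using vec.span_base by blast
    then show False using st(1) by (auto simp: D_pt span_pt)
  qed
  moreover have pts: "vec.span {?p} \<in> pg_points" "D \<in> pg_points" "vec.span {pt a b c} \<in> pg_points"
    unfolding pg_points_iff D_pt using st(1) assms
    by (metis pt_eq_0_iff field_embedding_eq_0_iff[OF emb] one_neq_zero)+
  moreover have "vec.span {?p} \<subseteq> ?W" "D \<subseteq> ?W"
    by (auto simp: D_pt intro!: vec.span_mono)
  ultimately have L: "?L \<in> special_lines \<pi> D"
    unfolding special_lines_def by blast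
  \<comment> \<open>The factor is found by dividing by whichever of \<open>\<iota> s\<close> and
    \<open>\<iota> t\<close> is nonzero.\<close>
  obtain x where "b = x * \<iota> s" "c = x * \<iota> t"
  proof (cases "s = 0")
    case True
    then show ?thesis using st by (intro that[of "c / \<iota> t"]) auto
  next
    case False
    then show ?thesis using st by (intro that[of "b / \<iota> s"]) (auto simp: field_simps)
  qed
  then have "pt a b c \<in> ?W"
    by (auto simp: span_pt2)
  then have "vec.span {pt a b c} \<in> ?L"
    using pts by (simp add: span_singleton_subset_iff)
  with L show "vec.span {pt a b c} \<in> rectangle_points \<pi> D"
    unfolding rectangle_points_def by blast
qed

section \<open>Lines avoiding \<open>D\<close> and their intersections\<close>

text \<open>A plane avoids \<open>pt 1 0 0\<close> exactly when its equation has a nonzero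
  coefficient at \<open>a\<close>. This coefficient is normalised to 1, so that
  \<open>(u, v)\<close> are affine coordinates of the line.\<close>

definition plane :: "'e \<Rightarrow> 'e \<Rightarrow> ('e^3) set" where
  "plane u v = {pt a b c | a b c. a + u * b + v * c = 0}"

lemma pt_mem_plane [simp]: "pt a b c \<in> plane u v \<longleftrightarrow> a + u * b + v * c = 0"
  by (auto simp: plane_def)

lemma plane_eq_span: "plane u v = vec.span {pt (- u) 1 0, pt (- v) 0 1}"
proof -
  have "a + u * b + v * c = 0 \<longleftrightarrow> a = b * - u + c * - v" for a b c
    by algebra
  then show ?thesis
    unfolding span_pt2 plane_def by simp
qed

lemma subspace_plane: "vec.subspace (plane u v)"
  by (simp add: plane_eq_span)

lemma dim_plane: "vec.dim (plane u v) = 2"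
  by (simp add: plane_eq_span vec.dim_insert span_pt)

text \<open>Since \<open>W\<close> is a complement of the direction \<open>pt 1 0 0\<close>, every
  vector can be moved into \<open>W\<close> along that direction. Moving the other two frame vectors
  produces \<open>u\<close> and \<open>v\<close>.\<close>

lemma plane_of_subspace:
  assumes W: "vec.subspace W" "vec.dim W = 2" and D: "pt 1 0 0 \<notin> W"
  obtains u v where "W = plane u v"
proof -
  have "vec.dim (insert (pt 1 0 0) W) = CARD(3)"
    using assms by (simp add: vec.dim_insert vec.span_eq_iff[THEN iffD2])
  then have full: "vec.span (insert (pt 1 0 0) W) = UNIV"
    using vec.dim_eq_full[of "insert (pt 1 0 0) W"] vec_dim_card[where 'a = 'e and 'n = 3]
    by (simp add: vec.dimension_def)
  have "\<exists>k. pt a b c - k *s pt 1 0 0 \<in> W" for a b c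
    using full vec.span_breakdown_eq[of "pt a b c" "pt 1 0 0" W] W(1)
    by (simp add: vec.span_eq_iff[THEN iffD2])
  then have ex: "\<exists>k. pt (a - k) b c \<in> W" for a b c
    by (simp add: pt_scale pt_diff)
  obtain u v where u: "pt (- u) 1 0 \<in> W" and v: "pt (- v) 0 1 \<in> W"
    using ex[of 0 1 0] ex[of 0 0 1] by auto
  have "plane u v \<subseteq> W"
    unfolding plane_eq_span using u v W(1) by (intro vec.span_minimal) auto
  then have "W = plane u v"
    using W dim_plane subspace_plane by (metis order_refl vec.subspace_dim_equal)
  then show thesis ..
qed

definition ordinary_line :: "'e \<Rightarrow> 'e \<Rightarrow> 'e pg_point set" where
  "ordinary_line u v = {P \<in> pg_points. P \<subseteq> plane u v} \<inter> rectangle_points \<pi> D"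

lemma span_pt_mem_ordinary_line:
  assumes "pt a b c \<noteq> 0"
  shows "vec.span {pt a b c} \<in> ordinary_line u v \<longleftrightarrow>
    a + u * b + v * c = 0 \<and> (\<exists>s t. (s \<noteq> 0 \<or> t \<noteq> 0) \<and> b * \<iota> t = c * \<iota> s)"
proof -
  have "vec.span {pt a b c} \<in> pg_points"
    using assms unfolding pg_points_iff by blast
  then show ?thesis
    using rectangle_points_iff[OF assms] unfolding ordinary_line_def
    by (simp add: span_singleton_subset_iff[OF subspace_plane])
qed

lemma ordinary_lines_eq: "ordinary_lines \<pi> D = {ordinary_line u v | u v. True}"
proof -
  have D: "D \<in> pg_points"
    unfolding pg_points_iff D_pt by (metis pt_eq_0_iff one_neq_zero)
  have "ordinary_line u v \<in> ordinary_lines \<pi> D" for u v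
  proof -
    let ?L = "{P \<in> pg_points. P \<subseteq> plane u v}"
    have "?L \<in> pg_lines"
      unfolding pg_lines_def using subspace_plane dim_plane by blast
    moreover have "D \<notin> ?L"
      by (simp add: D_pt span_singleton_subset_iff[OF subspace_plane])
    ultimately show ?thesis
      unfolding ordinary_lines_def ordinary_line_def by blast
  qed
  moreover have "\<exists>u v. l = ordinary_line u v" if l: "l \<in> ordinary_lines \<pi> D" for l
  proof -
    obtain W where W: "vec.subspace W" "vec.dim W = 2" "D \<notin> {P \<in> pg_points. P \<subseteq> W}"
      and lW: "l = {P \<in> pg_points. P \<subseteq> W} \<inter> rectangle_points \<pi> D"
      using l unfolding ordinary_lines_def pg_lines_def by blast
    have "pt 1 0 0 \<notin> W"
      using W D by (simp add: D_pt span_singleton_subset_iff)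
    then obtain u v where "W = plane u v"
      using plane_of_subspace W by metis
    with lW show ?thesis
      unfolding ordinary_line_def by blast
  qed
  ultimately show ?thesis by blast
qed

text \<open>Restriction to the rectangle loses no information: it keeps the points with
  \<open>c = 0\<close> and with \<open>b = 0\<close>, whose first coordinates reveal
  \<open>u\<close> and \<open>v\<close>.\<close>

lemma ordinary_line_eq_iff: "ordinary_line u v = ordinary_line u' v' \<longleftrightarrow> u = u' \<and> v = v'"
proof
  note [simp] = field_embedding_basics[OF emb]
  assume eq: "ordinary_line u v = ordinary_line u' v'"
  have "vec.span {pt (- u) 1 0} \<in> ordinary_line u v"
    by (subst span_pt_mem_ordinary_line) (auto intro: exI[of _ 1] exI[of _ 0])
  moreover have "vec.span {pt (- v) 0 1} \<in> ordinary_line u v"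
    by (subst span_pt_mem_ordinary_line) (auto intro: exI[of _ 1] exI[of _ 0])
  ultimately show "u = u' \<and> v = v'"
    unfolding eq by (simp add: span_pt_mem_ordinary_line)
qed simp

text \<open>Subtracting the equations of the two lines eliminates \<open>a\<close>, and at a
  rectangle point the remaining pair \<open>(b, c)\<close> may be replaced by a proportional pair
  from the small field.\<close>

lemma ordinary_lines_meet_iff:
  "(\<exists>P \<in> rectangle_points \<pi> D. P \<in> ordinary_line u v \<and> P \<in> ordinary_line u' v') \<longleftrightarrow>
    (\<exists>s t. (s \<noteq> 0 \<or> t \<noteq> 0) \<and> \<iota> s * (u - u') + \<iota> t * (v - v') = 0)"
proof
  note [simp] = field_embedding_basics[OF emb]
  assume "\<exists>P \<in> rectangle_points \<pi> D. P \<in> ordinary_line u v \<and> P \<in> ordinary_line u' v'"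
  then obtain P where P: "P \<in> ordinary_line u v" "P \<in> ordinary_line u' v'" by blast
  then have "P \<in> pg_points" by (simp add: ordinary_line_def)
  then obtain a b c where abc: "pt a b c \<noteq> 0" "P = vec.span {pt a b c}"
    unfolding pg_points_iff by (metis pt_cases)
  obtain s t where st: "s \<noteq> 0 \<or> t \<noteq> 0" "b * \<iota> t = c * \<iota> s"
    and eqs: "a + u * b + v * c = 0" "a + u' * b + v' * c = 0"
    using P abc by (auto simp: span_pt_mem_ordinary_line)
  \<comment> \<open>If both vanished, the line equation would force \<open>a = 0\<close> as
    well.\<close>
  have bc: "b \<noteq> 0 \<or> c \<noteq> 0"
    using eqs(1) abc(1) by auto
  have d: "b * (u - u') + c * (v - v') = 0"
    using eqs by algebra
  \<comment> \<open>Proportionality of \<open>(b, c)\<close> and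
    \<open>(\<iota> s, \<iota> t)\<close> transfers the relation \<open>d\<close> up to a factor
    \<open>b\<close> or \<open>c\<close>, and one of these is nonzero and can be cancelled.\<close>
  have "b * (\<iota> s * (u - u') + \<iota> t * (v - v')) = \<iota> s * (b * (u - u') + c * (v - v'))"
    using st(2) by algebra
  moreover have "c * (\<iota> s * (u - u') + \<iota> t * (v - v')) = \<iota> t * (b * (u - u') + c * (v - v'))"
    using st(2) by algebra
  ultimately have "\<iota> s * (u - u') + \<iota> t * (v - v') = 0"
    using bc d by (metis mult_eq_0_iff)
  then show "\<exists>s t. (s \<noteq> 0 \<or> t \<noteq> 0) \<and> \<iota> s * (u - u') + \<iota> t * (v - v') = 0"
    using st(1) by blast
next
  note [simp] = field_embedding_basics[OF emb]
  assume "\<exists>s t. (s \<noteq> 0 \<or> t \<noteq> 0) \<and> \<iota> s * (u - u') + \<iota> t * (v - v') = 0"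
  then obtain s t where st: "s \<noteq> 0 \<or> t \<noteq> 0" "\<iota> s * (u - u') + \<iota> t * (v - v') = 0" by blast
  \<comment> \<open>The first coordinate is solved from the equation of the first line; the assumed
    relation then gives the equation of the second.\<close>
  let ?w = "pt (- u * \<iota> s - v * \<iota> t) (\<iota> s) (\<iota> t)"
  have nz: "?w \<noteq> 0" using st(1) by auto
  have 1: "- u * \<iota> s - v * \<iota> t + u * \<iota> s + v * \<iota> t = 0"
    by simp
  have 2: "- u * \<iota> s - v * \<iota> t + u' * \<iota> s + v' * \<iota> t = 0"
    using st(2) by algebra
  have 3: "\<exists>s' t'. (s' \<noteq> 0 \<or> t' \<noteq> 0) \<and> \<iota> s * \<iota> t' = \<iota> t * \<iota> s'"
    using st(1) mult.commute by blast
  have "vec.span {?w} \<in> ordinary_line u v" "vec.span {?w} \<in> ordinary_line u' v'"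
    unfolding span_pt_mem_ordinary_line[OF nz] using 1 2 3 by blast+
  moreover from this have "vec.span {?w} \<in> rectangle_points \<pi> D"
    by (simp add: ordinary_line_def)
  ultimately show "\<exists>P \<in> rectangle_points \<pi> D. P \<in> ordinary_line u v \<and> P \<in> ordinary_line u' v'"
    by blast
qed

end

section \<open>The isomorphism from matrices to ordinary lines\<close>

theorem theorem4p6:
  fixes q k :: nat
    and \<iota> :: "'f::{field,finite} \<Rightarrow> 'e::{field,finite}"
    and \<pi> :: "'e pg_point set" and D :: "'e pg_point"
  assumes "primepow q" and "k > 1"
    and "CARD('f) = q" and "CARD('k::finite) = k" and "CARD('e) = q ^ k"
    and "field_embedding \<iota>"
    and "is_subplane_over \<iota> \<pi>"
    and "D \<in> \<pi>"
  shows "graph_isomorphic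
           (line_graph (pseudo_projective_rectangle \<pi> D) (ordinary_lines \<pi> D))
           (bilinear_forms_graph :: ('f^'k^2) graph)"
proof -
  obtain M where "invertible M"
    "\<pi> = {vec.span {M *v (\<chi> i. \<iota> (x $ i))} | x :: 'f^3. x \<noteq> 0}"
    "D = vec.span {M *v vector [1, 0, 0]}"
    using subplane_frame_at_point[OF assms(6-8)] .
  then interpret subplane_frame \<iota> M \<pi> D
    using assms(6) by unfold_locales
  have "CARD('e) = CARD('f) ^ CARD('k)"
    using assms(3-5) by simp
  then obtain \<phi> :: "'f^'k \<Rightarrow> 'e" where bij: "bij \<phi>"
    and add: "\<And>x y. \<phi> (x + y) = \<phi> x + \<phi> y" and scale: "\<And>c x. \<phi> (c *s x) = \<iota> c * \<phi> x"
    using field_embedding_coordinates[OF assms(6)] by blast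
  have inj: "\<phi> x = \<phi> y \<longleftrightarrow> x = y" for x y
    using bij by (simp add: bij_is_inj inj_eq)
  have zero: "\<phi> x = 0 \<longleftrightarrow> x = 0" for x
    using add[of 0 0] inj[of x 0] by (metis add.right_neutral add_left_cancel)
  have diff: "\<phi> (x - y) = \<phi> x - \<phi> y" for x y
    using add[of "x - y" y] by (simp only: diff_add_cancel eq_diff_eq)
  \<comment> \<open>The rows of the matrix are the coordinate vectors of \<open>u\<close> and
    \<open>v\<close> over the small field.\<close>
  define f :: "'f^'k^2 \<Rightarrow> 'e pg_point set"
    where "f A = ordinary_line (\<phi> (A $ 1)) (\<phi> (A $ 2))" for A
  have f_eq_iff: "f A = f B \<longleftrightarrow> A = B" for A B
    by (simp add: f_def ordinary_line_eq_iff inj vec_eq_iff[of A] forall_2)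
  have "bij_betw f UNIV (ordinary_lines \<pi> D)"
  proof (rule bij_betw_imageI)
    show "inj f"
      by (simp add: inj_def f_eq_iff)
    have "ordinary_line u v \<in> range f" for u v
    proof -
      obtain x y where "u = \<phi> x" "v = \<phi> y"
        using bij by (meson bij_pointE)
      then have "ordinary_line u v = f (vector [x, y])"
        by (simp add: f_def)
      then show ?thesis by blast
    qed
    then show "range f = ordinary_lines \<pi> D"
      unfolding ordinary_lines_eq f_def by blast
  qed
  \<comment> \<open>Applying the injective semilinear map \<open>\<phi>\<close> turns a dependence
    with coefficients \<open>s\<close>, \<open>t\<close> between the rows of \<open>A - B\<close>
    into the meeting condition of the two lines, with the same \<open>s\<close> and
    \<open>t\<close>.\<close>
  moreover have "rank (A - B) = 1 \<longleftrightarrow>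
    f A \<noteq> f B \<and> (\<exists>P \<in> rectangle_points \<pi> D. P \<in> f A \<and> P \<in> f B)" for A B
    unfolding rank_eq_1_iff_rows_dependent f_eq_iff
    unfolding f_def ordinary_lines_meet_iff
    by (simp add: zero[symmetric] add scale diff right_diff_distrib)
  ultimately have "graph_isomorphic (bilinear_forms_graph :: ('f^'k^2) graph)
    (line_graph (pseudo_projective_rectangle \<pi> D) (ordinary_lines \<pi> D))"
    unfolding graph_isomorphic_def bilinear_forms_graph_def line_graph_def
      pseudo_projective_rectangle_def by auto
  then show ?thesis
    by (rule graph_isomorphic_sym)
qed

end
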